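(* Let $n\ge 2$ and let $G\subseteq\mathbb N^n$. Then $\mathrm{Arf}(G)$ is well defined (i.e. the set $S(G)$ of all Arf semigroups of $\mathbb N^n$ containing $G$ has a minimum with respect to inclusion) if and only if the following conditions hold: (1) $\gcd\{g[i]: g\in G\}=1$ for $i=1,\dots,n$; (2) for all $i,j\in\{1,\dots,n\}$ with $i<j$ there exists $g\in G$ such that $g[i]\neq g[j]$.
   Context: $\mathbb N=\{0,1,2,\dots\}$; $v[i]$ is the $i$-th component of $v\in\mathbb N^n$; $\mathbb N^n$ has the componentwise partial order, and $\min(a,b)$ is the componentwise minimum. A good semigroup $S$ of $\mathbb N^n$ is a submonoid of $(\mathbb N^n,+)$ such that: (i) $\min(a,b)\in S$ for all $a,b\in S$; (ii) if $a,b\in S$ and $a[i]=b[i]$ for some $i\in\{1,\dots,n\}$, then there is $c\in S$ with $c[i]>a[i]=b[i]$, $c[j]\ge\min(a[j],b[j])$ for $j\ne i$, and $c[j]=\min(a[j],b[j])$ whenever $a[j]\ne b[j]$; (iii) there is $\delta\in S$ with $\delta+\mathbb N^n\subseteq S$. A good semigroup is local if the zero vector is its only element with some component equal to zero. All good semigroups considered are assumed to be local. An Arf semigroup of $\mathbb N^n$ is a (local) good semigroup $S$ such that $S(\alpha)-\alpha$ is a semigroup for each $\alpha\in S$, where $S(\alpha)=\{\beta\in S:\beta\ge\alpha\}$. For $G\subseteq\mathbb N^n$, $S(G)=\{S: S\subseteq\mathbb N^n\text{ is an Arf semigroup and }G\subseteq S\}$; if $S(G)$ has a minimum with respect to inclusion,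 this minimum is denoted $\mathrm{Arf}(G)$, and $\mathrm{Arf}(G)$ is said to be well defined.
   Formalization: It is additionally assumed that every vector of G with a zero component is the zero vector; otherwise no (local) Arf semigroup contains G, and e.g. G = {(1,0),(0,1)} satisfies (1) and (2) although S(G) is empty. *)

theory Defs
  imports "HOL-Analysis.Analysis"
begin

(* The library order on vec is componentwise and partial, so the polymorphic min is not
   the componentwise minimum. *)
definition vmin :: "nat ^ 'n \<Rightarrow> nat ^ 'n \<Rightarrow> nat ^ 'n" where
  "vmin a b = (\<chi> i. min (a $ i) (b $ i))"

definition add_closed :: "(nat ^ 'n) set \<Rightarrow> bool" where
  "add_closed S \<longleftrightarrow> (\<forall>a\<in>S. \<forall>b\<in>S. a + b \<in> S)"

definition submonoid :: "(nat ^ 'n) set \<Rightarrow> bool" where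
  "submonoid S \<longleftrightarrow> 0 \<in> S \<and> add_closed S"

definition good_semigroup :: "(nat ^ 'n) set \<Rightarrow> bool" where
  "good_semigroup S \<longleftrightarrow>
     submonoid S \<and>
     (\<forall>a\<in>S. \<forall>b\<in>S. vmin a b \<in> S) \<and>
     (\<forall>a\<in>S. \<forall>b\<in>S. \<forall>i. a $ i = b $ i \<longrightarrow>
        (\<exists>c\<in>S. c $ i > a $ i \<and>
           (\<forall>j. j \<noteq> i \<longrightarrow> c $ j \<ge> min (a $ j) (b $ j)) \<and>
           (\<forall>j. a $ j \<noteq> b $ j \<longrightarrow> c $ j = min (a $ j) (b $ j)))) \<and>
     (\<exists>d\<in>S. \<forall>v. d + v \<in> S)"

(* Stated for arbitrary sets of vectors: a set contained in a local semigroup is local in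
   this sense. *)
definition is_local :: "(nat ^ 'n) set \<Rightarrow> bool" where
  "is_local S \<longleftrightarrow> (\<forall>a\<in>S. (\<exists>i. a $ i = 0) \<longrightarrow> a = 0)"

definition above :: "(nat ^ 'n) set \<Rightarrow> nat ^ 'n \<Rightarrow> (nat ^ 'n) set" where
  "above S a = {b \<in> S. a \<le> b}"

(* The subtraction on nat is truncated, but here it is only applied to b \<ge> a. *)
definition arf_semigroup :: "(nat ^ 'n) set \<Rightarrow> bool" where
  "arf_semigroup S \<longleftrightarrow>
     good_semigroup S \<and> is_local S \<and>
     (\<forall>a\<in>S. add_closed ((\<lambda>b. b - a) ` above S a))"

definition arf_oversemigroups :: "(nat ^ 'n) set \<Rightarrow> (nat ^ 'n) set set" where
  "arf_oversemigroups G = {S. arf_semigroup S \<and> G \<subseteq> S}"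

definition arf_well_defined :: "(nat ^ 'n) set \<Rightarrow> bool" where
  "arf_well_defined G \<longleftrightarrow>
     (\<exists>S \<in> arf_oversemigroups G. \<forall>T \<in> arf_oversemigroups G. S \<subseteq> T)"

end

theory Submission
  imports Defs
begin

text \<open>
  Sufficiency: the intersection \<open>T\<close> of all Arf oversemigroups inherits everything except the
  existence of a conductor and property (ii). For the conductor, condition (1) makes each
  projection of \<open>T\<close> cofinite, and condition (2) then yields, for \<open>i \<noteq> j\<close>, elements
  \<open>p \<le> q\<close> of \<open>T\<close> agreeing at \<open>j\<close> but not at \<open>i\<close>; by the Arf property
  \<open>p + k (q - p) \<in> T\<close> for all \<open>k\<close>, so one coordinate can be kept while the others grow, and
  componentwise minima give all large vectors. For (ii), in an Arf semigroup the coordinates where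
  \<open>a\<close> and \<open>b\<close> agree can be raised to any prescribed values beyond the conductor, so a common
  witness for all oversemigroups exists.

  Necessity: if (1) or (2) fails, that failure can be imposed on all vectors below an arbitrary
  bound, which gives Arf oversemigroups with arbitrarily large conductor.
\<close>

section \<open>Numerical semigroups\<close>

lemma nat_mult_mem_of_add_closed:
  fixes A :: "nat set"
  assumes "0 \<in> A" "\<And>x y. x \<in> A \<Longrightarrow> y \<in> A \<Longrightarrow> x + y \<in> A" "x \<in> A"
  shows "k * x \<in> A"
  using assms by (induction k) auto

text \<open>The least positive difference \<open>d\<close> of two elements divides every element,
  hence is 1. Two consecutive elements \<open>a\<close> and \<open>a + 1\<close> then generate all
  large numbers.\<close>

lemma cofinite_of_Gcd_eq_1:
  fixes A :: "nat set"
  assumes zero: "0 \<in> A" and add: "\<And>x y. x \<in> A \<Longrightarrow> y \<in> A \<Longrightarrow> x + y \<in> A"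
    and Gcd: "Gcd A = 1"
  obtains N where "\<And>x. x \<ge> N \<Longrightarrow> x \<in> A"
proof -
  have mult: "k * x \<in> A" if "x \<in> A" for k x
    using nat_mult_mem_of_add_closed[of A] zero add that by blast
  define P where "P d \<longleftrightarrow> d > 0 \<and> (\<exists>a\<in>A. a + d \<in> A)" for d
  have "\<exists>g\<in>A. g \<noteq> 0"
    using Gcd Gcd_0_iff[of A] by auto
  then have ex: "\<exists>d. P d"
    unfolding P_def using zero by (metis add_0 gr0I)
  define d where "d = (LEAST d. P d)"
  have "P d"
    unfolding d_def using ex by (rule LeastI_ex)
  then obtain a where a: "d > 0" "a \<in> A" "a + d \<in> A"
    by (auto simp: P_def)
  have "d dvd g" if "g \<in> A" for g
  proof (rule ccontr)
    assume "\<not> d dvd g"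
    then have "g mod d > 0"
      by (simp add: mod_greater_zero_iff_not_dvd)
    define q where "q = g div d"
    have "q * (a + d) \<in> A" "g + q * a \<in> A"
      using a that add mult by blast+
    \<comment> \<open>Two elements of \<open>A\<close> thus differ by the remainder
      \<open>g mod d\<close>, a positive difference smaller than \<open>d\<close>.\<close>
    moreover have "q * (a + d) + g mod d = g + q * a"
      unfolding q_def by (simp add: algebra_simps)
    ultimately have "P (g mod d)"
      unfolding P_def using \<open>g mod d > 0\<close> by metis
    moreover have "g mod d < d"
      using a by simp
    ultimately show False
      unfolding d_def using not_less_Least by blast
  qed
  then have "d dvd 1"
    using Gcd Gcd_greatest by metis
  then have a1: "a + 1 \<in> A"
    using a by simp
  show thesis
  proof (rule that)
    \<comment> \<open>Beyond \<open>a * a\<close> the quotient by \<open>a\<close> exceeds the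
      remainder \<open>r\<close>, so \<open>r\<close> of its copies of \<open>a\<close> can be
      exchanged for \<open>a + 1\<close>.\<close>
    fix x assume x: "x \<ge> a * a"
    show "x \<in> A"
    proof (cases "a = 0")
      case True
      then show ?thesis using mult[OF a1, of x] by simp
    next
      case False
      define q r where "q = x div a" and "r = x mod a"
      have xqr: "x = q * a + r" and "r < a"
        using False by (auto simp: q_def r_def)
      have "a \<le> q"
        unfolding q_def using x False by (metis div_le_mono nonzero_mult_div_cancel_right)
      then obtain s where s: "q = s + r"
        using \<open>r < a\<close> by (metis add.commute le_Suc_ex less_imp_le_nat order_trans)
      have "x = s * a + r * (a + 1)"
        using xqr s by (simp add: algebra_simps)
      then show ?thesis
        using add mult a a1 by presburger
    qed
  qed
qed

section \<open>Submonoids closed under minima and Arf differences\<close>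

text \<open>The Arf condition translated back by \<open>a\<close>: \<open>b + c - a\<close> is
  \<open>a + (b - a) + (c - a)\<close>. In this form it visibly passes to intersections.\<close>

definition arf_closed :: "(nat ^ 'n) set \<Rightarrow> bool" where
  "arf_closed S \<longleftrightarrow> (\<forall>a\<in>S. \<forall>b\<in>S. \<forall>c\<in>S. a \<le> b \<longrightarrow> a \<le> c \<longrightarrow> b + c - a \<in> S)"

lemma add_closed_differences_iff:
  fixes S :: "(nat ^ 'n) set"
  shows "add_closed ((\<lambda>b. b - a) ` above S a) \<longleftrightarrow>
           (\<forall>b\<in>S. \<forall>c\<in>S. a \<le> b \<longrightarrow> a \<le> c \<longrightarrow> b + c - a \<in> S)"
    (is "?L \<longleftrightarrow> ?R")
proof
  assume L: ?L
  show ?R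
  proof (intro ballI impI)
    fix b c assume bc: "b \<in> S" "c \<in> S" "a \<le> b" "a \<le> c"
    then have "(b - a) + (c - a) \<in> (\<lambda>b. b - a) ` above S a"
      using L unfolding add_closed_def above_def by blast
    then obtain e where e: "e \<in> S" "a \<le> e" "(b - a) + (c - a) = e - a"
      by (auto simp: above_def)
    have "b + c - a = e"
      unfolding vec_eq_iff
    proof
      fix i
      have "(b - a) $ i + (c - a) $ i = (e - a) $ i"
        using e(3) by (metis vector_add_component)
      then show "(b + c - a) $ i = e $ i"
        using bc(3,4)[unfolded less_eq_vec_def, rule_format, of i]
          e(2)[unfolded less_eq_vec_def, rule_format, of i] by simp
    qed
    then show "b + c - a \<in> S" using e by simp
  qed
next
  assume R: ?R
  show ?L
    unfolding add_closed_def above_def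
  proof clarsimp
    fix b c assume bc: "b \<in> S" "c \<in> S" "a \<le> b" "a \<le> c"
    have "b - a + (c - a) = (b + c - a) - a"
      using bc(3,4) by (simp add: vec_eq_iff less_eq_vec_def)
    moreover have "a \<le> b + c - a"
      using bc(3,4) unfolding less_eq_vec_def
      by (metis add_le_mono diff_add_inverse diff_le_mono vector_add_component vector_minus_component)
    ultimately show "b - a + (c - a) \<in> (\<lambda>b. b - a) ` {b \<in> S. a \<le> b}"
      using R bc by blast
  qed
qed

lemma arf_semigroup_iff:
  "arf_semigroup S \<longleftrightarrow> good_semigroup S \<and> is_local S \<and> arf_closed S"
  unfolding arf_semigroup_def arf_closed_def add_closed_differences_iff by blast

lemma submonoid_sum:
  assumes "submonoid S" "\<And>x. x \<in> X \<Longrightarrow> f x \<in> S"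
  shows "sum f X \<in> S"
  using assms(2)
  by (induction X rule: infinite_finite_induct)
    (use assms(1) in \<open>auto simp: submonoid_def add_closed_def\<close>)

lemma submonoid_smult:
  fixes S :: "(nat ^ 'n) set"
  assumes "submonoid S" "x \<in> S"
  shows "k *s x \<in> S"
proof -
  have "k *s x = (\<Sum>_<k. x)"
    unfolding vec_eq_iff sum_component by simp
  then show ?thesis
    using submonoid_sum[OF assms(1), of "{..<k}" "\<lambda>_. x"] assms(2) by simp
qed

text \<open>Lets the Arf property be iterated: increments above \<open>m\<close> can be summed and
  repeated at will.\<close>

lemma arf_closed_imp_submonoid_differences:
  fixes S :: "(nat ^ 'n) set"
  assumes "arf_closed S" "m \<in> S"
  shows "submonoid {d. m + d \<in> S}"
proof -
  have "m + (x + y) \<in> S" if "m + x \<in> S" "m + y \<in> S" for x y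
  proof -
    have "(m + x) + (m + y) - m \<in> S"
      using assms that unfolding arf_closed_def by (simp add: less_eq_vec_def)
    moreover have "(m + x) + (m + y) - m = m + (x + y)"
      by (simp add: vec_eq_iff)
    ultimately show ?thesis by simp
  qed
  then show ?thesis
    using assms(2) by (auto simp: submonoid_def add_closed_def)
qed

lemma vmin_component [simp]: "vmin a b $ i = min (a $ i) (b $ i)"
  by (simp add: vmin_def)

section \<open>Coordinate projections and the existence of a conductor\<close>

lemma Gcd_component_superset:
  fixes G T :: "(nat ^ 'n) set"
  assumes "Gcd {g $ i | g. g \<in> G} = 1" "G \<subseteq> T"
  shows "Gcd {t $ i | t. t \<in> T} = 1"
proof -
  have "Gcd {t $ i | t. t \<in> T} dvd Gcd {g $ i | g. g \<in> G}"
    by (rule Gcd_greatest) (use assms(2) in \<open>auto intro!: Gcd_dvd\<close>)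
  then show ?thesis using assms(1) by simp
qed

lemma component_cofinite:
  fixes T :: "(nat ^ 'n) set"
  assumes "submonoid T" "Gcd {t $ i | t. t \<in> T} = 1"
  obtains N where "\<And>x. x \<ge> N \<Longrightarrow> \<exists>t\<in>T. t $ i = x"
proof -
  have zero: "0 \<in> {t $ i | t. t \<in> T}"
    using assms(1) unfolding submonoid_def by (force intro: exI[of _ 0])
  have add: "x + y \<in> {t $ i | t. t \<in> T}"
    if xy: "x \<in> {t $ i | t. t \<in> T}" "y \<in> {t $ i | t. t \<in> T}" for x y
  proof -
    from xy obtain s t where "s \<in> T" "t \<in> T" "x = s $ i" "y = t $ i" by auto
    then show ?thesis
      using assms(1) unfolding submonoid_def add_closed_def
      by (auto intro!: exI[of _ "s + t"])
  qed
  obtain N where "\<And>x. x \<ge> N \<Longrightarrow> x \<in> {t $ i | t. t \<in> T}"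
    using cofinite_of_Gcd_eq_1[OF zero add assms(2)] by blast
  then show thesis using that by blast
qed

text \<open>If coordinate \<open>j\<close> were a function of coordinate \<open>i\<close>, it would be multiplication by an integer
  constant, which the gcd condition at \<open>j\<close> forces to be 1.\<close>
lemma exists_separating_pair:
  fixes T :: "(nat ^ 'n) set"
  assumes T: "submonoid T"
    and Gi: "Gcd {t $ i | t. t \<in> T} = 1" and Gj: "Gcd {t $ j | t. t \<in> T} = 1"
    and g: "g \<in> T" "g $ i \<noteq> g $ j"
  obtains p q where "p \<in> T" "q \<in> T" "p $ i = q $ i" "p $ j \<noteq> q $ j"
proof (rule ccontr)
  assume "\<not> thesis"
  with that have fn: "\<And>p q. p \<in> T \<Longrightarrow> q \<in> T \<Longrightarrow> p $ i = q $ i \<Longrightarrow> p $ j = q $ j"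
    by blast
  obtain N where N: "\<And>x. x \<ge> N \<Longrightarrow> \<exists>t\<in>T. t $ i = x"
    using component_cofinite[OF T Gi] by blast
  obtain u w where u: "u \<in> T" "u $ i = N" and w: "w \<in> T" "w $ i = N + 1"
    using N[of N] N[of "N + 1"] by auto
  \<comment> \<open>The multiples \<open>s $ i *s t\<close> and \<open>t $ i *s s\<close> agree at
    \<open>i\<close>, hence at \<open>j\<close>.\<close>
  have cross: "s $ i * t $ j = t $ i * s $ j" if "s \<in> T" "t \<in> T" for s t
    using fn[OF submonoid_smult[OF T that(2), of "s $ i"] submonoid_smult[OF T that(1), of "t $ i"]]
    by (simp add: mult.commute)
  \<comment> \<open>Since \<open>u\<close> and \<open>w\<close> take consecutive values at
    \<open>i\<close>, subtracting their two instances of \<open>cross\<close> isolates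
    \<open>s $ j\<close>. The slope lives in \<open>int\<close> until its sign is known.\<close>
  define r where "r = int (w $ j) - int (u $ j)"
  have r: "int (s $ j) = r * int (s $ i)" if "s \<in> T" for s
  proof -
    have "int (s $ i) * int (u $ j) = int N * int (s $ j)"
      "int (s $ i) * int (w $ j) = int (N + 1) * int (s $ j)"
      using cross[OF that u(1)] cross[OF that w(1)] u w by (metis of_nat_mult)+
    then show ?thesis unfolding r_def by (simp add: algebra_simps)
  qed
  have "0 \<le> r * int (N + 1)"
    using r[OF w(1)] w(2) by (metis of_nat_0_le_iff)
  then have "r \<ge> 0"
    by (auto simp: zero_le_mult_iff)
  then obtain k where k: "r = int k"
    using nonneg_int_cases by blast
  have "k dvd s $ j" if "s \<in> T" for s
    using r[OF that] k by (metis dvd_triv_left of_nat_eq_iff of_nat_mult)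
  then have "k dvd Gcd {t $ j | t. t \<in> T}"
    by (intro Gcd_greatest) auto
  then have "k = 1" using Gj by simp
  then show False using r[OF g(1)] k g(2) by simp
qed

lemma raise_other_component:
  fixes T :: "(nat ^ 'n) set"
  assumes T: "submonoid T" "arf_closed T" and vmin: "\<And>a b. a \<in> T \<Longrightarrow> b \<in> T \<Longrightarrow> vmin a b \<in> T"
    and Gi: "Gcd {t $ i | t. t \<in> T} = 1" and Gj: "Gcd {t $ j | t. t \<in> T} = 1"
    and g: "g \<in> T" "g $ i \<noteq> g $ j"
  shows "\<exists>x. \<forall>k. \<exists>t\<in>T. t $ i = x \<and> t $ j \<ge> k"
proof -
  obtain p q where pq: "p \<in> T" "q \<in> T" "p $ i = q $ i" "p $ j < q $ j"
    using exists_separating_pair[OF T(1) Gi Gj g] by (metis linorder_neqE_nat)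
  \<comment> \<open>\<open>p\<close> need not lie below \<open>q\<close>; their minimum does, and it
    still agrees with \<open>q\<close> at \<open>i\<close> and with \<open>p\<close> at
    \<open>j\<close>.\<close>
  define m where "m = vmin p q"
  define d where "d = q - m"
  have m: "m \<in> T" and md: "m + d = q"
    using pq vmin by (auto simp: m_def d_def vec_eq_iff)
  have d: "d $ i = 0" "d $ j > 0"
    using pq by (auto simp: m_def d_def)
  have "m + k *s d \<in> T" for k
    using submonoid_smult[OF arf_closed_imp_submonoid_differences[OF T(2) m]] pq(2) md by simp
  moreover have "(m + k *s d) $ i = m $ i" "(m + k *s d) $ j \<ge> k" for k
    using d by (auto simp: trans_le_add2)
  ultimately show ?thesis by blast
qed

text \<open>First, any large value can be prescribed at one coordinate while all others are
  arbitrarily large. A large \<open>v\<close> is then a minimum of such elements above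
  \<open>v\<close>, one matching it at each coordinate.\<close>

lemma exists_conductor:
  fixes T :: "(nat ^ 'n) set"
  assumes T: "submonoid T" "arf_closed T" and vmin: "\<And>a b. a \<in> T \<Longrightarrow> b \<in> T \<Longrightarrow> vmin a b \<in> T"
    and Gcd: "\<And>i. Gcd {t $ i | t. t \<in> T} = 1"
    and sep: "\<And>i j. i \<noteq> j \<Longrightarrow> \<exists>g\<in>T. g $ i \<noteq> g $ j"
  shows "\<exists>d. \<forall>v. d \<le> v \<longrightarrow> v \<in> T"
proof -
  have "\<exists>N. \<forall>x\<ge>N. \<forall>k. \<exists>t\<in>T. t $ i = x \<and> (\<forall>j. j \<noteq> i \<longrightarrow> t $ j \<ge> k)" for i
  proof -
    have "\<forall>j\<in>-{i}. \<exists>x. \<forall>k. \<exists>t\<in>T. t $ i = x \<and> t $ j \<ge> k"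
      using raise_other_component[OF T vmin Gcd Gcd] sep by (metis ComplD singletonI)
    then obtain x where x: "\<And>j k. j \<noteq> i \<Longrightarrow> \<exists>t\<in>T. t $ i = x j \<and> t $ j \<ge> k"
      by (metis ComplI singletonD)
    obtain N where N: "\<And>y. y \<ge> N \<Longrightarrow> \<exists>t\<in>T. t $ i = y"
      using component_cofinite[OF T(1) Gcd] by blast
    show ?thesis
    proof (intro exI allI impI)
      \<comment> \<open>Each \<open>t j\<close> makes coordinate \<open>j\<close> large at the fixed
        cost \<open>x j\<close> in coordinate \<open>i\<close>; \<open>h\<close> supplies what
        remains of \<open>y\<close>.\<close>
      fix y k assume y: "y \<ge> N + sum x (-{i})"
      obtain h where h: "h \<in> T" "h $ i = y - sum x (-{i})"
        using N y by (metis add_le_imp_le_diff)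
      obtain t where t: "\<And>j. j \<noteq> i \<Longrightarrow> t j \<in> T \<and> t j $ i = x j \<and> t j $ j \<ge> k"
      proof -
        have "\<forall>j\<in>-{i}. \<exists>t. t \<in> T \<and> t $ i = x j \<and> t $ j \<ge> k"
          using x by blast
        from bchoice[OF this] obtain f where "\<forall>j\<in>-{i}. f j \<in> T \<and> f j $ i = x j \<and> f j $ j \<ge> k"
          by (rule exE)
        then show thesis by (intro that[of f]) simp
      qed
      define s where "s = h + sum t (-{i})"
      have "s \<in> T"
      proof -
        have "sum t (-{i}) \<in> T"
          by (rule submonoid_sum[OF T(1)]) (use t in simp)
        then show ?thesis
          using h(1) T(1) unfolding s_def submonoid_def add_closed_def by blast
      qed
      moreover have "s $ i = y"
      proof -
        have "(\<Sum>j\<in>-{i}. t j $ i) = sum x (-{i})"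
          by (rule sum.cong) (use t in auto)
        then show ?thesis using h y by (simp add: s_def)
      qed
      moreover have "s $ j \<ge> k" if "j \<noteq> i" for j
      proof -
        have "t j $ j \<le> (\<Sum>l\<in>-{i}. t l $ j)"
          by (rule member_le_sum) (use that in auto)
        then show ?thesis using t[OF that] by (simp add: s_def)
      qed
      ultimately show "\<exists>t\<in>T. t $ i = y \<and> (\<forall>j. j \<noteq> i \<longrightarrow> t $ j \<ge> k)" by blast
    qed
  qed
  then have "\<forall>i. \<exists>N. \<forall>x\<ge>N. \<forall>k. \<exists>t\<in>T. t $ i = x \<and> (\<forall>j. j \<noteq> i \<longrightarrow> t $ j \<ge> k)"
    by (rule allI)
  from choice[OF this] obtain N
    where N: "\<forall>i. \<forall>x\<ge>N i. \<forall>k. \<exists>t\<in>T. t $ i = x \<and> (\<forall>j. j \<noteq> i \<longrightarrow> t $ j \<ge> k)"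
    by (rule exE)
  have "v \<in> T" if v: "(\<chi> i. N i) \<le> v" for v
  proof -
    have vN: "v $ i \<ge> N i" for i
      using v by (simp add: less_eq_vec_def)
    have above: "\<exists>t\<in>T. v \<le> t \<and> t $ i = v $ i" for i
    proof -
      \<comment> \<open>The sum of the entries of \<open>v\<close> serves as one bound for all of
        them.\<close>
      obtain t where t: "t \<in> T" "t $ i = v $ i" "\<And>j. j \<noteq> i \<Longrightarrow> t $ j \<ge> sum (($) v) UNIV"
        using N[rule_format, OF vN] by blast
      have "v $ j \<le> t $ j" for j
      proof (cases "j = i")
        case False
        have "v $ j \<le> sum (($) v) UNIV"
          by (rule member_le_sum) auto
        then show ?thesis using t(3)[OF False] by linarith
      qed (use t in simp)
      then show ?thesis using t by (auto simp: less_eq_vec_def)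
    qed
    have "\<exists>t\<in>T. v \<le> t \<and> (\<forall>i\<in>I. t $ i = v $ i)" if "finite I" for I
      using that
    proof induction
      case empty
      then show ?case using above by blast
    next
      case (insert i I)
      then obtain t where t: "t \<in> T" "v \<le> t" "\<forall>j\<in>I. t $ j = v $ j" by blast
      obtain u where u: "u \<in> T" "v \<le> u" "u $ i = v $ i" using above by blast
      have "v \<le> vmin t u" "\<forall>j\<in>insert i I. vmin t u $ j = v $ j"
        using t(2,3) u(2,3) by (auto simp: less_eq_vec_def min_absorb1 min_absorb2)
      then show ?case using vmin[OF t(1) u(1)] by blast
    qed
    from this[of UNIV] obtain t where "t \<in> T" "\<forall>i. t $ i = v $ i" by auto
    then have "t = v" by (simp add: vec_eq_iff)
    then show ?thesis using \<open>t \<in> T\<close> by simp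
  qed
  then show ?thesis by blast
qed

section \<open>Intersections of Arf semigroups\<close>

lemma good_semigroup_conductor:
  fixes S :: "(nat ^ 'n) set"
  assumes "good_semigroup S"
  obtains d where "\<And>v. d \<le> v \<Longrightarrow> v \<in> S"
proof -
  have "\<exists>d\<in>S. \<forall>v. d + v \<in> S"
    using assms unfolding good_semigroup_def by (elim conjE)
  then obtain d where d: "\<And>v. d + v \<in> S"
    by blast
  have "v \<in> S" if "d \<le> v" for v
  proof -
    have "d + (v - d) = v"
      using that by (simp add: vec_eq_iff less_eq_vec_def)
    then show ?thesis using d by metis
  qed
  then show thesis using that by blast
qed

lemma good_semigroup_submonoid: "good_semigroup S \<Longrightarrow> submonoid S"
  unfolding good_semigroup_def by (elim conjE)

lemma good_semigroup_vmin:
  assumes "good_semigroup S" "a \<in> S" "b \<in> S"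
  shows "vmin a b \<in> S"
proof -
  have "\<forall>a\<in>S. \<forall>b\<in>S. vmin a b \<in> S"
    using assms(1) unfolding good_semigroup_def by (elim conjE)
  then show ?thesis using assms(2,3) by blast
qed

lemma good_semigroup_raise:
  fixes S :: "(nat ^ 'n) set"
  assumes "good_semigroup S" "a \<in> S" "b \<in> S" "a $ i = b $ i"
  shows "\<exists>c. c \<in> S \<and> c $ i > a $ i \<and> vmin a b \<le> c \<and>
           (\<forall>j. a $ j \<noteq> b $ j \<longrightarrow> c $ j = min (a $ j) (b $ j))"
proof -
  have "\<forall>a\<in>S. \<forall>b\<in>S. \<forall>i. a $ i = b $ i \<longrightarrow>
        (\<exists>c\<in>S. c $ i > a $ i \<and>
           (\<forall>j. j \<noteq> i \<longrightarrow> c $ j \<ge> min (a $ j) (b $ j)) \<and>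
           (\<forall>j. a $ j \<noteq> b $ j \<longrightarrow> c $ j = min (a $ j) (b $ j)))"
    using assms(1) unfolding good_semigroup_def by (elim conjE)
  from this[rule_format, OF assms(2-4)] obtain c where c: "c \<in> S" "c $ i > a $ i"
      "\<forall>j. j \<noteq> i \<longrightarrow> c $ j \<ge> min (a $ j) (b $ j)"
      "\<forall>j. a $ j \<noteq> b $ j \<longrightarrow> c $ j = min (a $ j) (b $ j)"
    by (elim bexE conjE)
  have "vmin a b $ j \<le> c $ j" for j
    using c(2,3) by (cases "j = i") auto
  then have "vmin a b \<le> c"
    by (simp add: less_eq_vec_def)
  then show ?thesis using c by (intro exI[of _ c] conjI)
qed

text \<open>The vector \<open>v\<close> does not depend on \<open>S\<close>: this gives one witness of property (ii) for
  all Arf semigroups containing \<open>a\<close>, \<open>b\<close> and everything above \<open>d\<close>.\<close>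
lemma arf_semigroup_raise_mem:
  fixes S :: "(nat ^ 'n) set"
  assumes S: "good_semigroup S" "arf_closed S" and ab: "a \<in> S" "b \<in> S"
    and d: "\<And>v. d \<le> v \<Longrightarrow> v \<in> S"
    and v: "\<And>j. a $ j = b $ j \<Longrightarrow> v $ j \<ge> max (d $ j) (a $ j)"
      "\<And>j. a $ j \<noteq> b $ j \<Longrightarrow> v $ j = min (a $ j) (b $ j)"
  shows "v \<in> S"
proof -
  define m where "m = vmin a b"
  define J where "J = {j. a $ j = b $ j}"
  note vmin = good_semigroup_vmin[OF S(1)]
  have m: "m \<in> S"
    unfolding m_def using vmin ab by blast
  have "\<forall>i\<in>J. \<exists>c. c \<in> S \<and> c $ i > a $ i \<and> m \<le> c \<and>
      (\<forall>j. a $ j \<noteq> b $ j \<longrightarrow> c $ j = min (a $ j) (b $ j))"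
    using good_semigroup_raise[OF S(1) ab] by (simp add: J_def m_def)
  from bchoice[OF this] obtain c where c: "\<forall>i\<in>J. c i \<in> S \<and> c i $ i > a $ i \<and> m \<le> c i \<and>
      (\<forall>j. a $ j \<noteq> b $ j \<longrightarrow> c i $ j = min (a $ j) (b $ j))"
    by (rule exE)
  have c: "c i \<in> S" "c i $ i > a $ i" "m $ j \<le> c i $ j" "j \<notin> J \<Longrightarrow> c i $ j = m $ j"
    if "i \<in> J" for i j
    using c[rule_format, OF that] by (simp_all add: less_eq_vec_def J_def m_def)
  define D where "D = {d. m + d \<in> S}"
  have D: "submonoid D"
    unfolding D_def using arf_closed_imp_submonoid_differences S(2) m .
  define e where "e = (\<Sum>i\<in>J. c i - m)"
  have "c i - m \<in> D" if "i \<in> J" for i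
  proof -
    have "m + (c i - m) = c i"
      using c(3)[OF that] by (simp add: vec_eq_iff)
    then show ?thesis using c(1)[OF that] by (simp add: D_def)
  qed
  then have "e \<in> D"
    unfolding e_def by (rule submonoid_sum[OF D])
  define k where "k = sum (($) v) UNIV"
  have kv: "v $ j \<le> k" for j
    unfolding k_def by (intro member_le_sum) auto
  have mem: "m + k *s e \<in> S"
    using submonoid_smult[OF D \<open>e \<in> D\<close>] by (simp add: D_def)
  have off: "(m + k *s e) $ j = m $ j" if "j \<notin> J" for j
    using that c(4) by (simp add: e_def)
  have on: "v $ j \<le> (m + k *s e) $ j" if "j \<in> J" for j
  proof -
    have "c j $ j - m $ j \<le> e $ j"
      unfolding e_def sum_component vector_minus_component
      by (rule member_le_sum) (use that in auto)
    then have "1 \<le> e $ j"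
      using c(2)[OF that] that by (simp add: m_def J_def)
    then have "k * 1 \<le> k * e $ j" by (rule mult_le_mono2)
    then have "v $ j \<le> k * e $ j" using kv[of j] by linarith
    then show ?thesis by simp
  qed
  define w where "w = (\<chi> j. if j \<in> J then v $ j else max (d $ j) (m $ j))"
  have w: "w \<in> S"
    by (rule d) (use v(1) in \<open>auto simp: less_eq_vec_def w_def J_def\<close>)
  have "vmin w (m + k *s e) = v"
    unfolding vec_eq_iff
  proof
    fix j
    show "vmin w (m + k *s e) $ j = v $ j"
    proof (cases "j \<in> J")
      case True
      then show ?thesis using on[OF True] by (simp add: w_def)
    next
      case False
      then have "v $ j = m $ j" using v(2) by (simp add: J_def m_def)
      then have "(m + k *s e) $ j = v $ j" "v $ j \<le> w $ j"
        using off[OF False] False by (simp_all only: w_def vec_lambda_beta if_False max.cobounded2)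
      then show ?thesis by (simp only: vmin_component min_absorb2)
    qed
  qed
  with vmin[OF w mem] show ?thesis by (simp only:)
qed

lemma arf_semigroup_Inter:
  fixes F :: "(nat ^ 'n) set set"
  assumes F: "F \<noteq> {}" "\<And>S. S \<in> F \<Longrightarrow> arf_semigroup S"
    and d: "\<And>v. d \<le> v \<Longrightarrow> v \<in> \<Inter>F"
  shows "arf_semigroup (\<Inter>F)"
proof -
  have S: "good_semigroup S" "is_local S" "arf_closed S" if "S \<in> F" for S
    using F(2)[OF that] by (auto simp: arf_semigroup_iff)
  have "submonoid (\<Inter>F)" "\<forall>a\<in>\<Inter>F. \<forall>b\<in>\<Inter>F. vmin a b \<in> \<Inter>F"
    using good_semigroup_submonoid[OF S(1)] good_semigroup_vmin[OF S(1)]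
    by (auto simp: submonoid_def add_closed_def)
  moreover have "\<exists>c\<in>\<Inter>F. c $ i > a $ i \<and> (\<forall>j. j \<noteq> i \<longrightarrow> c $ j \<ge> min (a $ j) (b $ j)) \<and>
           (\<forall>j. a $ j \<noteq> b $ j \<longrightarrow> c $ j = min (a $ j) (b $ j))"
    if "a \<in> \<Inter>F" "b \<in> \<Inter>F" "a $ i = b $ i" for a b i
  proof -
    define v where
      "v = (\<chi> j. if a $ j = b $ j then max (d $ j) (a $ j + 1) else min (a $ j) (b $ j))"
    have "v \<in> S" if "S \<in> F" for S
    proof (rule arf_semigroup_raise_mem[OF S(1,3)[OF that]])
      show "a \<in> S" "b \<in> S" "\<And>v. d \<le> v \<Longrightarrow> v \<in> S"
        using that d \<open>a \<in> \<Inter>F\<close> \<open>b \<in> \<Inter>F\<close> by auto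
    qed (auto simp: v_def)
    then show ?thesis
      using that(3) by (intro bexI[of _ v]) (auto simp: v_def)
  qed
  moreover have "\<exists>d\<in>\<Inter>F. \<forall>v. d + v \<in> \<Inter>F"
    by (intro bexI[of _ d] allI d) (auto simp: less_eq_vec_def)
  ultimately have "good_semigroup (\<Inter>F)"
    unfolding good_semigroup_def by (intro conjI ballI allI impI) simp_all
  moreover have "is_local (\<Inter>F)"
    using F(1) S(2) unfolding is_local_def by blast
  moreover have "arf_closed (\<Inter>F)"
    using S(3) unfolding arf_closed_def by blast
  ultimately show ?thesis
    by (simp add: arf_semigroup_iff)
qed

section \<open>Arf semigroups of positive vectors\<close>

lemma arf_semigroup_positive:
  fixes P :: "nat ^ 'n \<Rightarrow> bool"
  assumes add: "\<And>a b. P a \<Longrightarrow> P b \<Longrightarrow> P (a + b)"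
    and vmin: "\<And>a b. P a \<Longrightarrow> P b \<Longrightarrow> P (vmin a b)"
    and arf: "\<And>a b c. P a \<Longrightarrow> P b \<Longrightarrow> P c \<Longrightarrow> a \<le> b \<Longrightarrow> a \<le> c \<Longrightarrow> P (b + c - a)"
    and raise: "\<And>a b i. P a \<Longrightarrow> P b \<Longrightarrow> a $ i = b $ i \<Longrightarrow>
      \<exists>c. P c \<and> vmin a b \<le> c \<and> c $ i > a $ i \<and> (\<forall>j. a $ j \<noteq> b $ j \<longrightarrow> c $ j = min (a $ j) (b $ j))"
    and cond: "\<And>v. (\<And>i. v $ i \<ge> K) \<Longrightarrow> P v"
  shows "arf_semigroup (insert 0 {v. (\<forall>i. v $ i > 0) \<and> P v})" (is "arf_semigroup ?S")
proof -
  have top: "v \<in> ?S" if "\<And>i. v $ i \<ge> Suc K" for v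
  proof -
    have "K \<le> v $ i" "0 < v $ i" for i
      using that[of i] by auto
    then show ?thesis using cond by blast
  qed
  have add_mem: "a + b \<in> ?S" if "a \<in> ?S" "b \<in> ?S" for a b
  proof (cases "a = 0 \<or> b = 0")
    case True
    then show ?thesis using that by (elim disjE) simp_all
  next
    case False
    then show ?thesis using that add by simp
  qed
  then have "submonoid ?S"
    unfolding submonoid_def add_closed_def by blast
  moreover have "vmin a b \<in> ?S" if "a \<in> ?S" "b \<in> ?S" for a b
  proof (cases "a = 0 \<or> b = 0")
    case True
    then have "vmin a b = 0" by (auto simp: vec_eq_iff)
    then show ?thesis by simp
  next
    case False
    then show ?thesis using that vmin by auto
  qed
  moreover have "\<exists>c\<in>?S. c $ i > a $ i \<and> (\<forall>j. j \<noteq> i \<longrightarrow> c $ j \<ge> min (a $ j) (b $ j)) \<and>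
           (\<forall>j. a $ j \<noteq> b $ j \<longrightarrow> c $ j = min (a $ j) (b $ j))"
    if ab: "a \<in> ?S" "b \<in> ?S" "a $ i = b $ i" for a b i
  proof (cases "a = 0 \<or> b = 0")
    case True
    then have "a = 0" "b = 0"
      using ab by (metis (mono_tags, lifting) insertE less_irrefl mem_Collect_eq zero_index)+
    then show ?thesis
      using top[of "\<chi> i. Suc K"] by (intro bexI[of _ "\<chi> i. Suc K"]) auto
  next
    case False
    then have "P a" "P b" and pos: "\<And>j. a $ j > 0" "\<And>j. b $ j > 0" using ab by auto
    then obtain c where c: "P c" "vmin a b \<le> c" "c $ i > a $ i"
      "\<And>j. a $ j \<noteq> b $ j \<Longrightarrow> c $ j = min (a $ j) (b $ j)"
      using raise ab(3) by metis
    have le: "min (a $ j) (b $ j) \<le> c $ j" for j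
      using c(2) by (simp add: less_eq_vec_def)
    have "c $ j > 0" for j
      using le[of j] pos[of j] by linarith
    then show ?thesis using c le by (intro bexI[of _ c]) auto
  qed
  moreover have "\<exists>d\<in>?S. \<forall>v. d + v \<in> ?S"
    by (intro bexI[of _ "\<chi> i. Suc K"] allI top) auto
  ultimately have "good_semigroup ?S"
    unfolding good_semigroup_def by (intro conjI ballI allI impI) simp_all
  moreover have "is_local ?S"
    unfolding is_local_def
    by (metis (no_types, lifting) insertE less_irrefl mem_Collect_eq)
  moreover have "b + c - a \<in> ?S" if abc: "a \<in> ?S" "b \<in> ?S" "c \<in> ?S" "a \<le> b" "a \<le> c" for a b c
  proof (cases "a = 0")
    case True
    then show ?thesis using add_mem[OF abc(2,3)] by simp
  next
    case False
    then have a: "P a" "\<And>i. a $ i > 0" using abc by auto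
    have le: "a $ i \<le> b $ i" "a $ i \<le> c $ i" for i
      using abc by (auto simp: less_eq_vec_def)
    have "b \<noteq> 0" "c \<noteq> 0"
      using a(2) le by (metis le_zero_eq less_irrefl zero_index)+
    then have "P b" "P c" using abc by auto
    then have "P (b + c - a)" using arf a abc by blast
    moreover have "(b + c - a) $ i > 0" for i
      using a(2)[of i] le[of i] by simp
    ultimately show ?thesis by simp
  qed
  ultimately show ?thesis
    unfolding arf_semigroup_iff arf_closed_def by blast
qed

lemma is_local_pos:
  assumes "is_local G" "g \<in> G" "g \<noteq> 0"
  shows "g $ i > 0"
  using assms unfolding is_local_def by (metis gr0I)

text \<open>For \<open>d = 1\<close> this is the largest local semigroup.\<close>
lemma arf_semigroup_dvd_below:
  fixes i :: "'n::finite"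
  assumes "d > 0"
  shows "arf_semigroup (insert 0 {v :: nat ^ 'n. (\<forall>j. v $ j > 0) \<and> (d dvd v $ i \<or> K \<le> v $ i)})"
proof (rule arf_semigroup_positive[where K = K])
  fix a b c :: "nat ^ 'n"
  assume P: "d dvd a $ i \<or> K \<le> a $ i" "d dvd b $ i \<or> K \<le> b $ i" "d dvd c $ i \<or> K \<le> c $ i"
    and le: "a \<le> b" "a \<le> c"
  have le: "a $ i \<le> b $ i" "a $ i \<le> c $ i"
    using le by (auto simp: less_eq_vec_def)
  show "d dvd (b + c - a) $ i \<or> K \<le> (b + c - a) $ i"
  proof (cases "K \<le> b $ i \<or> K \<le> c $ i")
    case True
    then show ?thesis using le by auto
  next
    case False
    then have "d dvd a $ i" "d dvd b $ i" "d dvd c $ i" using P le by auto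
    then show ?thesis by (simp add: dvd_diff_nat)
  qed
next
  fix a b :: "nat ^ 'n" and l
  assume P: "d dvd a $ i \<or> K \<le> a $ i" "d dvd b $ i \<or> K \<le> b $ i" and l: "a $ l = b $ l"
  define c where "c = (\<chi> j. min (a $ j) (b $ j) + (if j = l then d else 0))"
  have "d dvd c $ i \<or> K \<le> c $ i"
    using P by (auto simp: c_def min_def)
  moreover have "vmin a b \<le> c" "c $ l > a $ l"
    "\<forall>j. a $ j \<noteq> b $ j \<longrightarrow> c $ j = min (a $ j) (b $ j)"
    using assms l by (auto simp: c_def less_eq_vec_def)
  ultimately show "\<exists>c. (d dvd c $ i \<or> K \<le> c $ i) \<and> vmin a b \<le> c \<and> c $ l > a $ l \<and>
      (\<forall>j. a $ j \<noteq> b $ j \<longrightarrow> c $ j = min (a $ j) (b $ j))"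
    by blast
qed (auto simp: min_def)

lemma arf_semigroup_equal_below:
  fixes i j :: "'n::finite"
  shows "arf_semigroup (insert 0 {v :: nat ^ 'n. (\<forall>l. v $ l > 0) \<and>
           (v $ i = v $ j \<or> K \<le> v $ i \<and> K \<le> v $ j)})"
proof (rule arf_semigroup_positive[where K = K])
  fix a b c :: "nat ^ 'n"
  assume P: "a $ i = a $ j \<or> K \<le> a $ i \<and> K \<le> a $ j" "b $ i = b $ j \<or> K \<le> b $ i \<and> K \<le> b $ j"
    "c $ i = c $ j \<or> K \<le> c $ i \<and> K \<le> c $ j" and le: "a \<le> b" "a \<le> c"
  have "a $ i \<le> b $ i" "a $ i \<le> c $ i" "a $ j \<le> b $ j" "a $ j \<le> c $ j"
    using le by (auto simp: less_eq_vec_def)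
  then show "(b + c - a) $ i = (b + c - a) $ j \<or> K \<le> (b + c - a) $ i \<and> K \<le> (b + c - a) $ j"
    using P by auto
next
  fix a b :: "nat ^ 'n" and l
  assume P: "a $ i = a $ j \<or> K \<le> a $ i \<and> K \<le> a $ j" "b $ i = b $ j \<or> K \<le> b $ i \<and> K \<le> b $ j"
    and l: "a $ l = b $ l"
  define L where "L = (if l \<in> {i, j} \<and> a $ l < K then {i, j} else {l})"
  define c where "c = (\<chi> x. min (a $ x) (b $ x) + (if x \<in> L then 1 else 0))"
  have L: "a $ x = b $ x" if "x \<in> L" for x
    using that l P by (auto simp: L_def split: if_splits)
  have "c $ i = c $ j \<or> K \<le> c $ i \<and> K \<le> c $ j"
    using P l by (auto simp: c_def L_def)
  moreover have "vmin a b \<le> c" "\<forall>x. a $ x \<noteq> b $ x \<longrightarrow> c $ x = min (a $ x) (b $ x)"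
    using L by (auto simp: c_def less_eq_vec_def)
  moreover have "c $ l > a $ l"
    using l by (auto simp: c_def L_def)
  ultimately show "\<exists>c. (c $ i = c $ j \<or> K \<le> c $ i \<and> K \<le> c $ j) \<and> vmin a b \<le> c \<and>
      c $ l > a $ l \<and> (\<forall>x. a $ x \<noteq> b $ x \<longrightarrow> c $ x = min (a $ x) (b $ x))"
    by blast
qed auto

section \<open>The criterion\<close>

lemma arf_well_defined_conductor:
  fixes G :: "(nat ^ 'n) set"
  assumes "arf_well_defined G"
  obtains d where "\<And>v T. d \<le> v \<Longrightarrow> arf_semigroup T \<Longrightarrow> G \<subseteq> T \<Longrightarrow> v \<in> T"
proof -
  obtain S where S: "arf_semigroup S" "\<And>T. arf_semigroup T \<Longrightarrow> G \<subseteq> T \<Longrightarrow> S \<subseteq> T"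
    using assms unfolding arf_well_defined_def arf_oversemigroups_def by blast
  then have "good_semigroup S" by (simp add: arf_semigroup_iff)
  then obtain d where "\<And>v. d \<le> v \<Longrightarrow> v \<in> S"
    using good_semigroup_conductor by blast
  then show thesis using that S(2) by blast
qed

lemma arf_well_defined_imp_Gcd:
  fixes G :: "(nat ^ 'n) set"
  assumes "arf_well_defined G" "is_local G"
  shows "Gcd {g $ i | g. g \<in> G} = 1"
proof (rule ccontr)
  assume "Gcd {g $ i | g. g \<in> G} \<noteq> 1"
  then obtain p where p: "prime p" "p dvd Gcd {g $ i | g. g \<in> G}"
    using prime_factor_nat by blast
  have pG: "p dvd g $ i" if "g \<in> G" for g
    using p(2) by (rule dvd_trans) (use that in \<open>auto intro!: Gcd_dvd\<close>)
  have p2: "p \<ge> 2" using p(1) by (rule prime_ge_2_nat)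
  obtain d where d: "\<And>v T. d \<le> v \<Longrightarrow> arf_semigroup T \<Longrightarrow> G \<subseteq> T \<Longrightarrow> v \<in> T"
    using arf_well_defined_conductor[OF assms(1)] by blast
  define K where "K = p * d $ i + 2"
  define v where "v = (\<chi> j. if j = i then p * d $ i + 1 else d $ j)"
  define T where "T = insert 0 {v :: nat ^ 'n. (\<forall>j. v $ j > 0) \<and> (p dvd v $ i \<or> K \<le> v $ i)}"
  have "1 * d $ i \<le> p * d $ i"
    using p2 by (intro mult_le_mono1) simp
  then have "d $ i \<le> p * d $ i + 1"
    by linarith
  then have "d \<le> v"
    by (simp add: v_def less_eq_vec_def)
  moreover have "G \<subseteq> T"
    using pG is_local_pos[OF assms(2)] by (auto simp: T_def)
  moreover have "arf_semigroup T"
    unfolding T_def using p2 by (intro arf_semigroup_dvd_below) auto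
  ultimately have "v \<in> T" using d by blast
  moreover have "v $ i = p * d $ i + 1" by (simp add: v_def)
  ultimately have "p dvd p * d $ i + 1"
    by (auto simp: T_def K_def)
  then have "p dvd 1"
    by (simp only: dvd_add_right_iff dvd_triv_left)
  then show False using p2 by simp
qed

lemma arf_well_defined_imp_separating:
  fixes G :: "(nat ^ 'n) set"
  assumes "arf_well_defined G" "is_local G" "i \<noteq> j"
  shows "\<exists>g\<in>G. g $ i \<noteq> g $ j"
proof (rule ccontr)
  assume "\<not> ?thesis"
  then have eq: "g $ i = g $ j" if "g \<in> G" for g
    using that by blast
  obtain d where d: "\<And>v T. d \<le> v \<Longrightarrow> arf_semigroup T \<Longrightarrow> G \<subseteq> T \<Longrightarrow> v \<in> T"
    using arf_well_defined_conductor[OF assms(1)] by blast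
  define M where "M = d $ i + d $ j + 1"
  define v where "v = (\<chi> l. if l = i then M else if l = j then M + 1 else d $ l)"
  define T where "T = insert 0 {v :: nat ^ 'n. (\<forall>l. v $ l > 0) \<and>
           (v $ i = v $ j \<or> M + 2 \<le> v $ i \<and> M + 2 \<le> v $ j)}"
  have "d \<le> v"
    by (auto simp: v_def M_def less_eq_vec_def)
  moreover have "G \<subseteq> T"
    using eq is_local_pos[OF assms(2)] by (auto simp: T_def)
  moreover have "arf_semigroup T"
    unfolding T_def by (rule arf_semigroup_equal_below)
  ultimately have "v \<in> T" using d by blast
  moreover have "v $ i = M" "v $ j = M + 1" using assms(3) by (auto simp: v_def)
  ultimately show False by (auto simp: T_def)
qed

lemma arf_well_defined_if:
  fixes G :: "(nat ^ 'n) set"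
  assumes local: "is_local G"
    and Gcd: "\<And>i. Gcd {g $ i | g. g \<in> G} = 1"
    and sep: "\<And>i j. i \<noteq> j \<Longrightarrow> \<exists>g\<in>G. g $ i \<noteq> g $ j"
  shows "arf_well_defined G"
proof -
  define F where "F = arf_oversemigroups G"
  define T where "T = \<Inter>F"
  have F: "arf_semigroup S" "G \<subseteq> S" if "S \<in> F" for S
    using that by (auto simp: F_def arf_oversemigroups_def)
  define L :: "(nat ^ 'n) set"
    where "L = insert 0 {v. (\<forall>j. v $ j > 0) \<and> (1 dvd v $ undefined \<or> 0 \<le> v $ undefined)}"
  have "arf_semigroup L"
    unfolding L_def by (rule arf_semigroup_dvd_below) simp
  moreover have "G \<subseteq> L"
    using is_local_pos[OF local] by (auto simp: L_def)
  ultimately have "F \<noteq> {}"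
    by (auto simp: F_def arf_oversemigroups_def)
  have good: "good_semigroup S" "arf_closed S" if "S \<in> F" for S
    using F(1)[OF that] by (auto simp: arf_semigroup_iff)
  have "G \<subseteq> T" using F(2) by (auto simp: T_def)
  have "\<exists>d. \<forall>v. d \<le> v \<longrightarrow> v \<in> T"
  proof (rule exists_conductor)
    show "submonoid T" "\<And>a b. a \<in> T \<Longrightarrow> b \<in> T \<Longrightarrow> vmin a b \<in> T"
      using good_semigroup_submonoid[OF good(1)] good_semigroup_vmin[OF good(1)]
      by (auto simp: T_def submonoid_def add_closed_def)
    show "arf_closed T"
      using good(2) unfolding T_def arf_closed_def by blast
    show "Gcd {t $ i | t. t \<in> T} = 1" for i
      using Gcd_component_superset[OF Gcd \<open>G \<subseteq> T\<close>] .
    show "\<exists>g\<in>T. g $ i \<noteq> g $ j" if "i \<noteq> j" for i j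
      using sep[OF that] \<open>G \<subseteq> T\<close> by blast
  qed
  then obtain d where d: "\<And>v. d \<le> v \<Longrightarrow> v \<in> \<Inter>F" unfolding T_def by blast
  have "arf_semigroup T"
    unfolding T_def using \<open>F \<noteq> {}\<close> F(1) d by (rule arf_semigroup_Inter)
  then have "T \<in> F"
    using \<open>G \<subseteq> T\<close> by (simp add: F_def arf_oversemigroups_def)
  moreover have "\<forall>S\<in>F. T \<subseteq> S"
    by (auto simp: T_def)
  ultimately show ?thesis
    unfolding arf_well_defined_def F_def by (rule bexI[rotated])
qed

theorem theorem2p1:
  fixes G :: "(nat ^ 'n) set"
  assumes "CARD('n) \<ge> 2"
    and "is_local G"
  shows "arf_well_defined G \<longleftrightarrow>
           (\<forall>i. Gcd {g $ i | g. g \<in> G} = 1) \<and>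
           (\<forall>i j. i \<noteq> j \<longrightarrow> (\<exists>g\<in>G. g $ i \<noteq> g $ j))"
proof (intro iffI conjI allI impI)
  assume G: "arf_well_defined G"
  show "Gcd {g $ i | g. g \<in> G} = 1" for i
    using arf_well_defined_imp_Gcd[OF G assms(2)] .
  show "\<exists>g\<in>G. g $ i \<noteq> g $ j" if "i \<noteq> j" for i j
    using arf_well_defined_imp_separating[OF G assms(2) that] .
next
  assume "(\<forall>i. Gcd {g $ i | g. g \<in> G} = 1) \<and>
          (\<forall>i j. i \<noteq> j \<longrightarrow> (\<exists>g\<in>G. g $ i \<noteq> g $ j))"
  then show "arf_well_defined G"
    using arf_well_defined_if[OF assms(2)] by simp
qed

end
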